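(* Let $f:\mathcal{M}\to\mathbb{R}$ be $\mathcal{C}^1$-smooth and let $L>0$. Suppose: (1) (descent condition) $f(\mathcal{R}_x(\eta))\le f(x)+\langle \mathrm{grad} f(x),\eta\rangle_x+\frac{L}{2}\|\eta\|^2$ for all $x\in\mathcal{M}$, $\eta\in T_x\mathcal{M}$; (2) (Lipschitz gradient, written $f\in\mathcal{C}^{1,L}$) $\|\mathcal{T}_y^x\,\mathrm{grad} f(y)-\mathrm{grad} f(x)\|\le L\|\eta\|$ for all $x\in\mathcal{M}$, $\eta\in T_x\mathcal{M}$, where $y=\mathcal{R}_x(\eta)$. Let $\nu\in[0,1)$ and let $\{t_k\}_{k\ge1}\subset[0,\infty)$ satisfy $$\sum_{k=1}^\infty t_k=\infty\quad\text{and}\quad t_k\in\Big[0,\frac{2-2\nu-\delta}{L(1+\nu)^2}\Big]$$ for all sufficiently large $k\in\mathbb{N}$ and for some $\delta>0$. Let $\{x_k\}_{k\ge1}\subset\mathcal{M}$ be a sequence generated by the IRGDr method $$x_{k+1}=\mathcal{R}_{x_k}(-t_kg_k),\quad g_k\in T_{x_k}\mathcal{M},\quad \|g_k-\mathrm{grad} f(x_k)\|\le\nu\|\mathrm{grad} f(x_k)\|,\qquad k=1,2,\ldots,$$ and suppose $\inf_k f(x_k)>-\infty$. Then either $f(x_k)\to-\infty$, or the following assertions hold: (i) Every accumulation point of $\{x_k\}$ is a stationary point of $f$. (ii) If $\{x_k\}$ has an accumulation point $\bar x$, then $f(x_k)\downarrow f(\bar x)$. (iii) If $f\in\mathcal{C}^{1,L}$,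 then $\mathrm{grad} f(x_k)\to0$.
   Context: $\mathcal{M}\subset\mathbb{R}^n$ is a Riemannian submanifold embedded in $\mathbb{R}^n$, with inner product $\langle\cdot,\cdot\rangle_x$ on $T_x\mathcal{M}$ varying smoothly in $x$ and induced norm $\|\cdot\|$ on tangent vectors. The Riemannian gradient $\mathrm{grad} f(x)\in T_x\mathcal{M}$ is the unique tangent vector with $\langle\mathrm{grad} f(x),\xi\rangle_x=Df(x)[\xi]$ for all $\xi\in T_x\mathcal{M}$; $\bar x$ is stationary for $f$ if $\mathrm{grad} f(\bar x)=0$. $\mathcal{R}:T\mathcal{M}\to\mathcal{M}$ is a retraction: a smooth map whose restriction $\mathcal{R}_x$ to $T_x\mathcal{M}$ satisfies $\mathcal{R}_x(0_x)=x$ and $D\mathcal{R}_x(0_x)=\mathrm{id}_{T_x\mathcal{M}}$. $\mathcal{T}$ is a vector transport: a smooth map $(\eta_x,\xi_x)\mapsto\mathcal{T}_{\eta_x}(\xi_x)\in T_{\mathcal{R}_x(\eta_x)}\mathcal{M}$, linear in $\xi_x$, with $\mathcal{T}_{0_x}\xi_x=\xi_x$; it is isometric: $\langle\mathcal{T}_{\eta_x}\xi_x,\mathcal{T}_{\eta_x}\zeta_x\rangle_{\mathcal{R}_x(\eta_x)}=\langle\xi_x,\zeta_x\rangle_x$. For $y=\mathcal{R}_x(\eta)$, $\mathcal{T}_y^x:T_y\mathcal{M}\to T_x\mathcal{M}$ denotes $\mathcal{T}_\eta^{-1}$. $f(x_k)\downarrow f(\bar x)$ means that $f(x_k)$ converges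 to $f(\bar x)$ and is nonincreasing for sufficiently large $k$. Accumulation points are taken in $\mathcal{M}$. *)

theory Defs
  imports "HOL-Analysis.Analysis" "HOL-Library.Extended_Nat"
begin

text \<open>Functions of class \<open>C\<^sup>k\<close> on an open set. Continuity of all iterated directional
  derivatives is used in place of continuity of the Frechet derivative in operator norm; for a
  domain of finite dimension the two agree.\<close>

primrec Cn_on_open :: "nat \<Rightarrow> ('a::euclidean_space \<Rightarrow> 'b::real_normed_vector) \<Rightarrow> 'a set \<Rightarrow> bool" where
  "Cn_on_open 0 F U \<longleftrightarrow> continuous_on U F"
| "Cn_on_open (Suc n) F U \<longleftrightarrow>
     (\<forall>x\<in>U. F differentiable (at x)) \<and>
     (\<forall>v. Cn_on_open n (\<lambda>x. frechet_derivative F (at x) v) U)"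

definition Ck_on_open :: "enat \<Rightarrow> ('a::euclidean_space \<Rightarrow> 'b::real_normed_vector) \<Rightarrow> 'a set \<Rightarrow> bool" where
  "Ck_on_open k F U \<longleftrightarrow> open U \<and> (\<forall>n. enat n \<le> k \<longrightarrow> Cn_on_open n F U)"

text \<open>Class \<open>C\<^sup>k\<close> on a subset of a Euclidean space, in the sense of local extensions. On an embedded
  submanifold (such as the tangent bundle, viewed inside the product space) this is the
  usual notion.\<close>

definition Ck_on :: "enat \<Rightarrow> ('a::euclidean_space \<Rightarrow> 'b::real_normed_vector) \<Rightarrow> 'a set \<Rightarrow> bool" where
  "Ck_on k f S \<longleftrightarrow>
     (\<forall>x\<in>S. \<exists>U F. x \<in> U \<and> Ck_on_open k F U \<and> (\<forall>y\<in>S \<inter> U. F y = f y))"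

abbreviation smooth_on :: "('a::euclidean_space \<Rightarrow> 'b::real_normed_vector) \<Rightarrow> 'a set \<Rightarrow> bool" where
  "smooth_on \<equiv> Ck_on \<infinity>"

text \<open>Embedded submanifolds via smooth slice charts; all charts share one model subspace \<open>E\<close>, so the
  dimension is the same at every point.\<close>

definition embedded_submanifold :: "'a::euclidean_space set \<Rightarrow> bool" where
  "embedded_submanifold M \<longleftrightarrow>
     (\<exists>E. subspace E \<and>
       (\<forall>x\<in>M. \<exists>U V (\<phi> :: 'a \<Rightarrow> 'a) \<psi>. x \<in> U \<and> Ck_on_open \<infinity> \<phi> U \<and> Ck_on_open \<infinity> \<psi> V \<and>
          homeomorphism U V \<phi> \<psi> \<and> \<phi> ` (M \<inter> U) = E \<inter> V))"

text \<open>\<open>c\<close> is (the germ at \<open>0\<close> of) a smooth curve in \<open>M\<close> through \<open>x\<close> with velocity \<open>v\<close>.\<close>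

definition curve_in :: "'a::euclidean_space set \<Rightarrow> 'a \<Rightarrow> 'a \<Rightarrow> (real \<Rightarrow> 'a) \<Rightarrow> bool" where
  "curve_in M x v c \<longleftrightarrow>
     (\<exists>e>0. Ck_on_open \<infinity> c {-e<..<e} \<and> c ` {-e<..<e} \<subseteq> M) \<and>
     c 0 = x \<and> (c has_vector_derivative v) (at 0)"

definition tangent_space :: "'a::euclidean_space set \<Rightarrow> 'a \<Rightarrow> 'a set" where
  "tangent_space M x = {v. \<exists>c. curve_in M x v c}"

definition tangent_bundle :: "'a::euclidean_space set \<Rightarrow> ('a \<times> 'a) set" where
  "tangent_bundle M = {(x, v). x \<in> M \<and> v \<in> tangent_space M x}"

definition tangent_bundle2 :: "'a::euclidean_space set \<Rightarrow> ('a \<times> 'a \<times> 'a) set" where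
  "tangent_bundle2 M = {(x, u, v). x \<in> M \<and> u \<in> tangent_space M x \<and> v \<in> tangent_space M x}"

text \<open>In what follows \<open>\<rho> x u v\<close> stands for the inner product of the tangent vectors \<open>u\<close> and \<open>v\<close> at \<open>x\<close>;
  it is meaningful only on \<open>tangent_bundle2 M\<close>.\<close>

definition riemannian_metric ::
  "'a::euclidean_space set \<Rightarrow> ('a \<Rightarrow> 'a \<Rightarrow> 'a \<Rightarrow> real) \<Rightarrow> bool" where
  "riemannian_metric M \<rho> \<longleftrightarrow>
     (\<forall>x\<in>M. \<forall>u\<in>tangent_space M x. \<forall>v\<in>tangent_space M x. \<forall>w\<in>tangent_space M x. \<forall>a b.
        \<rho> x (a *\<^sub>R u + b *\<^sub>R v) w = a * \<rho> x u w + b * \<rho> x v w) \<and>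
     (\<forall>x\<in>M. \<forall>u\<in>tangent_space M x. \<forall>v\<in>tangent_space M x. \<rho> x u v = \<rho> x v u) \<and>
     (\<forall>x\<in>M. \<forall>u\<in>tangent_space M x. u \<noteq> 0 \<longrightarrow> \<rho> x u u > 0) \<and>
     smooth_on (\<lambda>(x, u, v). \<rho> x u v) (tangent_bundle2 M)"

definition rnorm :: "('a \<Rightarrow> 'a \<Rightarrow> 'a \<Rightarrow> real) \<Rightarrow> 'a \<Rightarrow> 'a \<Rightarrow> real" where
  "rnorm \<rho> x v = sqrt (\<rho> x v v)"

text \<open>The differential \<open>Df(x)[v]\<close>: the common derivative of \<open>f\<close> along all curves with velocity \<open>v\<close>.\<close>

definition differential_on ::
  "'a::euclidean_space set \<Rightarrow> ('a \<Rightarrow> real) \<Rightarrow> 'a \<Rightarrow> 'a \<Rightarrow> real" where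
  "differential_on M f x v =
     (THE d. \<forall>c. curve_in M x v c \<longrightarrow> ((\<lambda>t. f (c t)) has_real_derivative d) (at 0))"

definition rgrad ::
  "'a::euclidean_space set \<Rightarrow> ('a \<Rightarrow> 'a \<Rightarrow> 'a \<Rightarrow> real) \<Rightarrow> ('a \<Rightarrow> real) \<Rightarrow> 'a \<Rightarrow> 'a" where
  "rgrad M \<rho> f x =
     (THE v. v \<in> tangent_space M x \<and> (\<forall>\<xi>\<in>tangent_space M x. \<rho> x v \<xi> = differential_on M f x \<xi>))"

definition stationary_point ::
  "'a::euclidean_space set \<Rightarrow> ('a \<Rightarrow> 'a \<Rightarrow> 'a \<Rightarrow> real) \<Rightarrow> ('a \<Rightarrow> real) \<Rightarrow> 'a \<Rightarrow> bool" where
  "stationary_point M \<rho> f x \<longleftrightarrow> x \<in> M \<and> rgrad M \<rho> f x = 0"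

text \<open>Retractions in the sense of optimization on manifolds, unrelated to the topological
  \<open>retraction\<close> of the library.\<close>

definition manifold_retraction :: "'a::euclidean_space set \<Rightarrow> ('a \<Rightarrow> 'a \<Rightarrow> 'a) \<Rightarrow> bool" where
  "manifold_retraction M R \<longleftrightarrow>
     smooth_on (\<lambda>(x, v). R x v) (tangent_bundle M) \<and>
     (\<forall>x\<in>M. \<forall>v\<in>tangent_space M x. R x v \<in> M) \<and>
     (\<forall>x\<in>M. R x 0 = x) \<and>
     (\<forall>x\<in>M. (R x has_derivative (\<lambda>v. v)) (at 0 within tangent_space M x))"

text \<open>\<open>T x \<eta> \<xi>\<close> is the transport of \<open>\<xi>\<close> along \<open>\<eta>\<close>, both tangent at \<open>x\<close>.\<close>

definition vector_transport ::
  "'a::euclidean_space set \<Rightarrow> ('a \<Rightarrow> 'a \<Rightarrow> 'a) \<Rightarrow> ('a \<Rightarrow> 'a \<Rightarrow> 'a \<Rightarrow> 'a) \<Rightarrow> bool" where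
  "vector_transport M R T \<longleftrightarrow>
     smooth_on (\<lambda>(x, \<eta>, \<xi>). T x \<eta> \<xi>) (tangent_bundle2 M) \<and>
     (\<forall>x\<in>M. \<forall>\<eta>\<in>tangent_space M x. \<forall>\<xi>\<in>tangent_space M x.
        T x \<eta> \<xi> \<in> tangent_space M (R x \<eta>)) \<and>
     (\<forall>x\<in>M. \<forall>\<eta>\<in>tangent_space M x. \<forall>\<xi>\<in>tangent_space M x. \<forall>\<zeta>\<in>tangent_space M x. \<forall>a b.
        T x \<eta> (a *\<^sub>R \<xi> + b *\<^sub>R \<zeta>) = a *\<^sub>R T x \<eta> \<xi> + b *\<^sub>R T x \<eta> \<zeta>) \<and>
     (\<forall>x\<in>M. \<forall>\<xi>\<in>tangent_space M x. T x 0 \<xi> = \<xi>)"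

definition isometric_transport ::
  "'a::euclidean_space set \<Rightarrow> ('a \<Rightarrow> 'a \<Rightarrow> 'a \<Rightarrow> real) \<Rightarrow> ('a \<Rightarrow> 'a \<Rightarrow> 'a) \<Rightarrow>
   ('a \<Rightarrow> 'a \<Rightarrow> 'a \<Rightarrow> 'a) \<Rightarrow> bool" where
  "isometric_transport M \<rho> R T \<longleftrightarrow>
     (\<forall>x\<in>M. \<forall>\<eta>\<in>tangent_space M x. \<forall>\<xi>\<in>tangent_space M x. \<forall>\<zeta>\<in>tangent_space M x.
        \<rho> (R x \<eta>) (T x \<eta> \<xi>) (T x \<eta> \<zeta>) = \<rho> x \<xi> \<zeta>)"

text \<open>For an isometric transport, \<open>T x \<eta>\<close> is injective on the tangent space at \<open>x\<close>, hence bijective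
  onto the tangent space at \<open>R x \<eta>\<close> because the dimensions agree; so this is a genuine inverse.\<close>

definition inv_transport ::
  "'a::euclidean_space set \<Rightarrow> ('a \<Rightarrow> 'a \<Rightarrow> 'a \<Rightarrow> 'a) \<Rightarrow> 'a \<Rightarrow> 'a \<Rightarrow> 'a \<Rightarrow> 'a" where
  "inv_transport M T x \<eta> = inv_into (tangent_space M x) (T x \<eta>)"

definition descent_condition ::
  "'a::euclidean_space set \<Rightarrow> ('a \<Rightarrow> 'a \<Rightarrow> 'a \<Rightarrow> real) \<Rightarrow> ('a \<Rightarrow> 'a \<Rightarrow> 'a) \<Rightarrow> ('a \<Rightarrow> real) \<Rightarrow> real \<Rightarrow> bool" where
  "descent_condition M \<rho> R f L \<longleftrightarrow>
     (\<forall>x\<in>M. \<forall>\<eta>\<in>tangent_space M x.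
        f (R x \<eta>) \<le> f x + \<rho> x (rgrad M \<rho> f x) \<eta> + L / 2 * (rnorm \<rho> x \<eta>)\<^sup>2)"

definition lipschitz_gradient ::
  "'a::euclidean_space set \<Rightarrow> ('a \<Rightarrow> 'a \<Rightarrow> 'a \<Rightarrow> real) \<Rightarrow> ('a \<Rightarrow> 'a \<Rightarrow> 'a) \<Rightarrow>
   ('a \<Rightarrow> 'a \<Rightarrow> 'a \<Rightarrow> 'a) \<Rightarrow> ('a \<Rightarrow> real) \<Rightarrow> real \<Rightarrow> bool" where
  "lipschitz_gradient M \<rho> R T f L \<longleftrightarrow>
     (\<forall>x\<in>M. \<forall>\<eta>\<in>tangent_space M x.
        rnorm \<rho> x (inv_transport M T x \<eta> (rgrad M \<rho> f (R x \<eta>)) - rgrad M \<rho> f x) \<le> L * rnorm \<rho> x \<eta>)"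

definition accumulation_point_in :: "'a::topological_space set \<Rightarrow> (nat \<Rightarrow> 'a) \<Rightarrow> 'a \<Rightarrow> bool" where
  "accumulation_point_in M x xbar \<longleftrightarrow>
     xbar \<in> M \<and> (\<exists>r::nat \<Rightarrow> nat. strict_mono r \<and> (x \<circ> r) \<longlonglongrightarrow> xbar)"

text \<open>Convergence to \<open>a\<close> that is nonincreasing from some index on.\<close>

definition decreases_to :: "(nat \<Rightarrow> real) \<Rightarrow> real \<Rightarrow> bool" where
  "decreases_to y a \<longleftrightarrow> y \<longlonglongrightarrow> a \<and> (\<forall>\<^sub>F k in sequentially. y (Suc k) \<le> y k)"

end

theory Submission
  imports Defs
begin

text \<open>Write \<open>G\<^sub>k\<close> for the norm of the gradient at \<open>x\<^sub>k\<close>. The descent condition and the step size bound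
  give \<open>f x\<^sub>k\<^sub>+\<^sub>1 \<le> f x\<^sub>k - (\<delta> / 2) t\<^sub>k G\<^sub>k\<^sup>2\<close>, so \<open>\<Sum> t\<^sub>k G\<^sub>k\<^sup>2 < \<infinity>\<close>. Since the transport is isometric, the Lipschitz
  condition yields \<open>\<bar>G\<^sub>k\<^sub>+\<^sub>1 - G\<^sub>k\<bar> \<le> C t\<^sub>k G\<^sub>k\<close>; as \<open>t\<^sub>k\<close> is bounded, the increments of \<open>G\<^sub>k\<^sup>2\<close> are
  summable and \<open>G\<^sub>k\<^sup>2\<close> converges. The limit is \<open>0\<close> because \<open>\<Sum> t\<^sub>k = \<infinity>\<close>.\<close>

lemma tendsto_zero_if_weighted_squares_summable:
  fixes a t :: "nat \<Rightarrow> real"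
  assumes t: "\<And>k. 0 \<le> t k" "\<And>k. t k \<le> B"
    and a: "\<And>k. 0 \<le> a k"
    and div: "\<not> summable t"
    and sq: "summable (\<lambda>k. t k * (a k)\<^sup>2)"
    and step: "\<And>k. \<bar>a (Suc k) - a k\<bar> \<le> C * t k * a k"
    and C: "0 \<le> C"
  shows "a \<longlonglongrightarrow> 0"
proof -
  have bound: "norm ((a (Suc k))\<^sup>2 - (a k)\<^sup>2) \<le> (C * (2 + C * B)) * (t k * (a k)\<^sup>2)" for k
  proof -
    have "a (Suc k) + a k \<le> 2 * a k + C * t k * a k"
      using step[of k] by linarith
    also have "\<dots> \<le> 2 * a k + C * B * a k"
      using t[of k] a[of k] C by (intro add_left_mono mult_right_mono mult_left_mono) auto
    finally have s: "a (Suc k) + a k \<le> (2 + C * B) * a k" by (simp add: algebra_simps)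
    have "norm ((a (Suc k))\<^sup>2 - (a k)\<^sup>2) = \<bar>a (Suc k) - a k\<bar> * (a (Suc k) + a k)"
      using a[of k] a[of "Suc k"] by (simp add: power2_eq_square square_diff_square_factored abs_mult)
    also have "\<dots> \<le> (C * t k * a k) * ((2 + C * B) * a k)"
      using step[of k] s a[of k] a[of "Suc k"] t[of k] C by (intro mult_mono) auto
    finally show ?thesis by (simp add: power2_eq_square algebra_simps)
  qed
  have "summable (\<lambda>k. (a (Suc k))\<^sup>2 - (a k)\<^sup>2)"
    by (rule summable_comparison_test'[OF summable_mult[OF sq, of "C * (2 + C * B)"]]) (rule bound)
  then have "convergent (\<lambda>n. \<Sum>k<n. (a (Suc k))\<^sup>2 - (a k)\<^sup>2)"
    by (simp add: summable_iff_convergent)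
  then have "convergent (\<lambda>n. (a n)\<^sup>2 - (a 0)\<^sup>2)"
    using sum_lessThan_telescope[of "\<lambda>n. (a n)\<^sup>2"] by simp
  then obtain l where "(\<lambda>n. (a n)\<^sup>2 - (a 0)\<^sup>2) \<longlonglongrightarrow> l"
    by (auto simp: convergent_def)
  then have "(\<lambda>n. ((a n)\<^sup>2 - (a 0)\<^sup>2) + (a 0)\<^sup>2) \<longlonglongrightarrow> l + (a 0)\<^sup>2"
    by (intro tendsto_add tendsto_const)
  then obtain m where m: "(\<lambda>n. (a n)\<^sup>2) \<longlonglongrightarrow> m" by auto
  have "m \<ge> 0" using m by (rule tendsto_lowerbound) auto
  have "m = 0"
  proof (rule ccontr)
    assume "m \<noteq> 0"
    with \<open>m \<ge> 0\<close> have "m / 2 < m" "m > 0" by auto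
    then have "\<forall>\<^sub>F k in sequentially. m / 2 < (a k)\<^sup>2"
      using order_tendstoD(1)[OF m] by blast
    then obtain N where N: "\<And>k. k \<ge> N \<Longrightarrow> m / 2 < (a k)\<^sup>2"
      by (auto simp: eventually_sequentially)
    have "norm (t k) \<le> (2 / m) * (t k * (a k)\<^sup>2)" if "k \<ge> N" for k
    proof -
      have "t k * (m / 2) \<le> t k * (a k)\<^sup>2"
        using N[OF that] t(1)[of k] by (intro mult_left_mono) auto
      then show ?thesis using \<open>m > 0\<close> t(1)[of k] by (simp add: field_simps)
    qed
    then have "summable t"
      by (rule summable_comparison_test'[OF summable_mult[OF sq, of "2 / m"]])
    with div show False ..
  qed
  with m have "(\<lambda>n. sqrt ((a n)\<^sup>2)) \<longlonglongrightarrow> sqrt 0" by (intro tendsto_real_sqrt) simp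
  then show ?thesis using a by simp
qed

subsection \<open>Inner products on a subspace\<close>

lemma linear_extend_from_subspace:
  fixes h :: "'a::euclidean_space \<Rightarrow> 'b::real_vector"
  assumes S: "subspace S"
    and lin: "\<And>u v a b. u \<in> S \<Longrightarrow> v \<in> S \<Longrightarrow> h (a *\<^sub>R u + b *\<^sub>R v) = a *\<^sub>R h u + b *\<^sub>R h v"
  obtains h' where "linear h'" "\<And>v. v \<in> S \<Longrightarrow> h' v = h v"
proof -
  obtain B where B: "B \<subseteq> S" "independent B" "S \<subseteq> span B"
    using basis_exists[of S] by metis
  have SB: "span B = S"
    using B S by (simp add: span_minimal subset_antisym)
  obtain h' where h': "linear h'" "\<forall>v\<in>B. h' v = h v"
    using linear_independent_extend[OF B(2)] by blast
  have "v \<in> span B \<and> h' v = h v" if "v \<in> span B" for v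
    using that
  proof (induction rule: span_induct_alt)
    case base
    have "h 0 = h (0 *\<^sub>R 0 + 0 *\<^sub>R 0)" by simp
    also have "\<dots> = 0 *\<^sub>R h 0 + 0 *\<^sub>R h 0" using subspace_0[OF S] by (intro lin)
    finally show ?case using h'(1) by (simp add: linear_0 span_zero)
  next
    case (step c u w)
    have "h (c *\<^sub>R u + 1 *\<^sub>R w) = c *\<^sub>R h u + 1 *\<^sub>R h w"
      using step SB B by (intro lin) auto
    then show ?case using step h' by (simp add: linear_add linear_scale span_add span_scale span_base)
  qed
  with h' SB that show ?thesis by blast
qed

lemma linear_inj_on_subspace_surj:
  fixes h :: "'a::euclidean_space \<Rightarrow> 'b::euclidean_space"
  assumes S: "subspace S" and S': "subspace S'"
    and lin: "\<And>u v a b. u \<in> S \<Longrightarrow> v \<in> S \<Longrightarrow> h (a *\<^sub>R u + b *\<^sub>R v) = a *\<^sub>R h u + b *\<^sub>R h v"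
    and ker: "\<And>v. v \<in> S \<Longrightarrow> h v = 0 \<Longrightarrow> v = 0"
    and into: "h ` S \<subseteq> S'" and dim: "dim S' \<le> dim S"
  shows "h ` S = S'"
proof -
  obtain h' where h': "linear h'" "\<And>v. v \<in> S \<Longrightarrow> h' v = h v"
    using linear_extend_from_subspace[of S h] S lin by blast
  have im: "h' ` S = h ` S" using h'(2) by auto
  have "inj_on h' S"
    using linear_inj_on_iff_eq_0[OF h'(1) S] h'(2) ker by auto
  then have "dim (h' ` S) = dim S"
    using S h'(1) by (intro dim_image_eq) (auto simp: span_eq_iff[THEN iffD2])
  moreover have "subspace (h' ` S)" using h'(1) S by (rule linear_subspace_image)
  ultimately show ?thesis
    using subspace_dim_equal[of "h' ` S" S'] S' into dim im by simp
qed

locale inner_on =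
  fixes S :: "'a::euclidean_space set" and p :: "'a \<Rightarrow> 'a \<Rightarrow> real"
  assumes subspace: "subspace S"
    and lin_left: "u \<in> S \<Longrightarrow> v \<in> S \<Longrightarrow> w \<in> S \<Longrightarrow> p (a *\<^sub>R u + b *\<^sub>R v) w = a * p u w + b * p v w"
    and sym: "u \<in> S \<Longrightarrow> v \<in> S \<Longrightarrow> p u v = p v u"
    and pos: "u \<in> S \<Longrightarrow> u \<noteq> 0 \<Longrightarrow> 0 < p u u"
begin

abbreviation N where "N v \<equiv> sqrt (p v v)"

lemma combination_in: "u \<in> S \<Longrightarrow> v \<in> S \<Longrightarrow> a *\<^sub>R u + b *\<^sub>R v \<in> S"
  using subspace by (simp add: subspace_add subspace_scale)

lemma lin_right:
  assumes "u \<in> S" "v \<in> S" "w \<in> S"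
  shows "p w (a *\<^sub>R u + b *\<^sub>R v) = a * p w u + b * p w v"
proof -
  have "p w (a *\<^sub>R u + b *\<^sub>R v) = p (a *\<^sub>R u + b *\<^sub>R v) w"
    using assms by (intro sym combination_in)
  also have "\<dots> = a * p u w + b * p v w" using assms by (rule lin_left)
  finally show ?thesis using sym[OF assms(1,3)] sym[OF assms(2,3)] by simp
qed

lemma zero_left: "w \<in> S \<Longrightarrow> p 0 w = 0"
  using lin_left[of 0 0 w 0 0] subspace_0[OF subspace] by simp

lemma zero_right: "w \<in> S \<Longrightarrow> p w 0 = 0"
  using zero_left[of w] sym[of w 0] subspace_0[OF subspace] by simp

lemma nonneg: "u \<in> S \<Longrightarrow> 0 \<le> p u u"
  using pos[of u] zero_left[of 0] by (cases "u = 0") (auto intro: less_imp_le)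

lemma self_eq_zero: "u \<in> S \<Longrightarrow> p u u = 0 \<Longrightarrow> u = 0"
  using pos[of u] by force

lemma expand:
  assumes "u \<in> S" "v \<in> S"
  shows "p (a *\<^sub>R u + b *\<^sub>R v) (a *\<^sub>R u + b *\<^sub>R v) = a\<^sup>2 * p u u + 2 * a * b * p u v + b\<^sup>2 * p v v"
  using assms by (simp add: lin_left lin_right combination_in sym[of v u] power2_eq_square algebra_simps)

lemma cauchy_schwarz:
  assumes "u \<in> S" "v \<in> S"
  shows "\<bar>p u v\<bar> \<le> N u * N v"
proof (cases "v = 0")
  case True
  then show ?thesis using assms by (simp add: zero_right)
next
  case False
  then have pv: "0 < p v v" using pos assms by blast
  have "0 \<le> (p v v)\<^sup>2 * p u u + 2 * p v v * (- p u v) * p u v + (- p u v)\<^sup>2 * p v v"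
    using nonneg[OF combination_in[of u v "p v v" "- p u v"]] assms by (simp only: expand)
  also have "\<dots> = p v v * (p u u * p v v - (p u v)\<^sup>2)"
    by (simp add: power2_eq_square algebra_simps)
  finally have "(p u v)\<^sup>2 \<le> p u u * p v v"
    using pv by (simp add: zero_le_mult_iff)
  then have "sqrt ((p u v)\<^sup>2) \<le> sqrt (p u u * p v v)" by (rule real_sqrt_le_mono)
  then show ?thesis by (simp add: real_sqrt_mult)
qed

lemma norm_power2: "u \<in> S \<Longrightarrow> (N u)\<^sup>2 = p u u"
  using nonneg by simp

lemma triangle:
  assumes "u \<in> S" "v \<in> S"
  shows "N (u + v) \<le> N u + N v"
proof (rule real_le_lsqrt)
  show "0 \<le> N u + N v" using assms by (simp add: nonneg)
  have "p (u + v) (u + v) = (N u)\<^sup>2 + 2 * p u v + (N v)\<^sup>2"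
    using expand[of u v 1 1] assms by (simp add: norm_power2 del: real_sqrt_pow2_iff)
  also have "\<dots> \<le> (N u + N v)\<^sup>2"
    using cauchy_schwarz[OF assms] by (simp add: power2_sum)
  finally show "p (u + v) (u + v) \<le> (N u + N v)\<^sup>2" .
qed

lemma norm_scale:
  assumes "u \<in> S"
  shows "N (a *\<^sub>R u) = \<bar>a\<bar> * N u"
  using expand[of u u a 0] assms by (simp add: real_sqrt_mult)

lemma reverse_triangle:
  assumes "u \<in> S" "v \<in> S"
  shows "\<bar>N u - N v\<bar> \<le> N (u - v)"
proof -
  have d: "u - v \<in> S" "v - u \<in> S" using assms subspace by (auto simp: subspace_diff)
  have "N (v - u) = N (u - v)" using norm_scale[OF d(1), of "-1"] by simp
  then show ?thesis
    using triangle[OF d(1) assms(2)] triangle[OF d(2) assms(1)] by simp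
qed

lemma inexact_direction:
  assumes G: "G \<in> S" and g: "g \<in> S" and err: "N (g - G) \<le> \<nu> * N G"
  shows "N g \<le> (1 + \<nu>) * N G" and "(1 - \<nu>) * (N G)\<^sup>2 \<le> p G g"
proof -
  have d: "g - G \<in> S" using g G subspace by (simp add: subspace_diff)
  have "g = G + (g - G)" by simp
  then have "N g \<le> N G + N (g - G)" using triangle[OF G d] by simp
  then show "N g \<le> (1 + \<nu>) * N G" using err by (simp add: algebra_simps)
  have "p G g = (N G)\<^sup>2 + p G (g - G)"
    using lin_right[OF G d G, of 1 1] G by (simp add: nonneg)
  moreover have "\<bar>p G (g - G)\<bar> \<le> N G * (\<nu> * N G)"
    using cauchy_schwarz[OF G d] mult_left_mono[OF err, of "N G"] nonneg[OF G] by simp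
  ultimately show "(1 - \<nu>) * (N G)\<^sup>2 \<le> p G g"
    by (simp add: power2_eq_square algebra_simps)
qed

lemma riesz:
  assumes l: "linear (l :: 'a \<Rightarrow> real)"
  shows "\<exists>!v. v \<in> S \<and> (\<forall>\<xi>\<in>S. p v \<xi> = l \<xi>)"
proof -
  obtain B where B: "B \<subseteq> S" "independent B" "S \<subseteq> span B"
    using basis_exists[of S] by metis
  have fin: "finite B" using B(2) by (rule independent_imp_finite)
  have SB: "span B = S"
    using B subspace by (simp add: span_minimal subset_antisym)
  define h where "h v = (\<Sum>b\<in>B. p v b *\<^sub>R b)" for v
  have coeff: "c b = d b" if "(\<Sum>b\<in>B. c b *\<^sub>R b) = (\<Sum>b\<in>B. d b *\<^sub>R b)" "b \<in> B" for c d b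
  proof -
    have "(\<Sum>b\<in>B. (c b - d b) *\<^sub>R b) = 0"
      using that by (simp add: scaleR_left_diff_distrib sum_subtractf)
    then show ?thesis
      using independentD[OF B(2) fin order_refl, of "\<lambda>b. c b - d b" b] that by simp
  qed
  have agree: "p v \<xi> = m \<xi>"
    if m: "linear m" "\<And>b. b \<in> B \<Longrightarrow> p v b = m b" and v: "v \<in> S" and \<xi>: "\<xi> \<in> S" for v \<xi> and m :: "'a \<Rightarrow> real"
  proof -
    obtain m' where m': "linear m'" "\<And>\<zeta>. \<zeta> \<in> S \<Longrightarrow> m' \<zeta> = p v \<zeta>"
      using linear_extend_from_subspace[OF subspace, of "p v"] lin_right[OF _ _ v] by auto
    have "m' \<xi> = m \<xi>"
      by (rule linear_eq_on[OF m'(1) m(1)]) (use m(2) \<xi> m'(2) SB B in auto)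
    then show ?thesis using m'(2) \<xi> by simp
  qed
  have "h ` S = S"
  proof (rule linear_inj_on_subspace_surj[OF subspace subspace])
    show "h (a *\<^sub>R u + b *\<^sub>R v) = a *\<^sub>R h u + b *\<^sub>R h v" if "u \<in> S" "v \<in> S" for u v a b
    proof -
      have "p (a *\<^sub>R u + b *\<^sub>R v) c = a * p u c + b * p v c" if "c \<in> B" for c
        using \<open>u \<in> S\<close> \<open>v \<in> S\<close> that B by (intro lin_left) auto
      then show ?thesis
        by (simp add: h_def scaleR_left_distrib sum.distrib scaleR_sum_right)
    qed
    show "v = 0" if "v \<in> S" "h v = 0" for v
    proof -
      have "p v b = 0" if "b \<in> B" for b
        using coeff[of "p v" "\<lambda>_. 0" b] \<open>h v = 0\<close> that by (simp add: h_def)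
      then have "p v v = 0"
        using agree[of "\<lambda>_. 0" v v] \<open>v \<in> S\<close> by (simp add: linear_zero)
      then show ?thesis using self_eq_zero that by blast
    qed
    show "h ` S \<subseteq> S"
      using B subspace by (auto simp: h_def intro!: subspace_sum subspace_scale)
  qed simp
  moreover have "(\<Sum>b\<in>B. l b *\<^sub>R b) \<in> S"
    using B subspace by (auto intro!: subspace_sum subspace_scale)
  ultimately obtain v where v: "v \<in> S" "h v = (\<Sum>b\<in>B. l b *\<^sub>R b)"
    by (metis (no_types, lifting) imageE)
  have "p v b = l b" if "b \<in> B" for b
    using coeff[of "p v" l b] v(2) that by (simp add: h_def)
  then have ex: "\<forall>\<xi>\<in>S. p v \<xi> = l \<xi>" using agree[OF l] v(1) by blast
  show ?thesis
  proof (rule ex1I[of _ v])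
    show "v \<in> S \<and> (\<forall>\<xi>\<in>S. p v \<xi> = l \<xi>)" using v(1) ex by blast
  next
    fix w assume w: "w \<in> S \<and> (\<forall>\<xi>\<in>S. p w \<xi> = l \<xi>)"
    then have d: "w - v \<in> S" using v subspace by (simp add: subspace_diff)
    then have "p (1 *\<^sub>R w + (-1) *\<^sub>R v) (w - v) = 1 * p w (w - v) + (-1) * p v (w - v)"
      using w v by (intro lin_left) auto
    then have "p (w - v) (w - v) = 0" using w ex d by simp
    then show "w = v" using self_eq_zero[OF d] by simp
  qed
qed

end

subsection \<open>Smooth functions and slice charts\<close>

lemma Cn_on_open_cong:
  assumes "Cn_on_open n F U" "open U" "\<And>x. x \<in> U \<Longrightarrow> F x = G x"
  shows "Cn_on_open n G U"
  using assms
proof (induction n arbitrary: F G)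
  case 0
  then show ?case using continuous_on_cong[of U U F G] by simp
next
  case (Suc n)
  have d: "F differentiable (at x)" if "x \<in> U" for x
    using Suc.prems that by simp
  have "G differentiable (at x)" if x: "x \<in> U" for x
  proof -
    obtain D where "(F has_derivative D) (at x)"
      using d[OF x] unfolding differentiable_def by blast
    then have "(G has_derivative D) (at x)"
      using \<open>open U\<close> x Suc.prems(3) by (rule has_derivative_transform_within_open)
    then show ?thesis by (rule differentiableI)
  qed
  moreover have "Cn_on_open n (\<lambda>x. frechet_derivative G (at x) v) U" for v
  proof (rule Suc.IH)
    show "Cn_on_open n (\<lambda>x. frechet_derivative F (at x) v) U" using Suc.prems by simp
    show "frechet_derivative F (at x) v = frechet_derivative G (at x) v" if "x \<in> U" for x
      using frechet_derivative_transform_within_open[OF d[OF that] \<open>open U\<close> that Suc.prems(3)] by simp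
  qed (rule \<open>open U\<close>)
  ultimately show ?case by simp
qed

lemma Cn_on_open_line:
  fixes F :: "'a::euclidean_space \<Rightarrow> 'b::real_normed_vector"
  assumes "Cn_on_open n F U" "open I" "\<And>s. s \<in> I \<Longrightarrow> a + s *\<^sub>R e \<in> U"
  shows "Cn_on_open n (\<lambda>s::real. F (a + s *\<^sub>R e)) I"
  using assms
proof (induction n arbitrary: F)
  case 0
  then have "continuous_on U F" "(\<lambda>s. a + s *\<^sub>R e) ` I \<subseteq> U" by auto
  then show ?case
    by (auto intro!: continuous_on_compose2[of U F] continuous_intros)
next
  case (Suc n)
  have der: "((\<lambda>s. F (a + s *\<^sub>R e)) has_derivative
      (\<lambda>h. frechet_derivative F (at (a + s *\<^sub>R e)) (h *\<^sub>R e))) (at s)" if "s \<in> I" for s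
  proof (rule has_derivative_compose[where g = F])
    show "((\<lambda>s. a + s *\<^sub>R e) has_derivative (\<lambda>h. h *\<^sub>R e)) (at s)"
      by (auto intro!: derivative_eq_intros)
    show "(F has_derivative frechet_derivative F (at (a + s *\<^sub>R e))) (at (a + s *\<^sub>R e))"
      using Suc.prems that frechet_derivative_works by auto
  qed
  have "Cn_on_open n (\<lambda>s. frechet_derivative (\<lambda>s. F (a + s *\<^sub>R e)) (at s) v) I" for v
  proof (rule Cn_on_open_cong[OF _ \<open>open I\<close>])
    show "Cn_on_open n (\<lambda>s. frechet_derivative F (at (a + s *\<^sub>R e)) (v *\<^sub>R e)) I"
      using Suc.prems by (intro Suc.IH) auto
    show "frechet_derivative F (at (a + s *\<^sub>R e)) (v *\<^sub>R e)
        = frechet_derivative (\<lambda>s. F (a + s *\<^sub>R e)) (at s) v" if "s \<in> I" for s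
      using frechet_derivative_at[OF der[OF that]] by metis
  qed
  moreover have "(\<lambda>s. F (a + s *\<^sub>R e)) differentiable (at s)" if "s \<in> I" for s
    using der[OF that] unfolding differentiable_def by blast
  ultimately show ?case by simp
qed

lemma Ck_on_open_1D:
  assumes "Ck_on_open k F U" "1 \<le> k"
  shows "open U" "continuous_on U F"
    "\<And>x. x \<in> U \<Longrightarrow> (F has_derivative frechet_derivative F (at x)) (at x)"
    "\<And>v. continuous_on U (\<lambda>x. frechet_derivative F (at x) v)"
proof -
  show "open U" using assms by (simp add: Ck_on_open_def)
  have *: "enat 0 \<le> k" "enat (Suc 0) \<le> k"
    using assms(2) by (auto simp: one_enat_def zero_enat_def[symmetric])
  then have c: "Cn_on_open 0 F U" "Cn_on_open (Suc 0) F U"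
    using assms(1) unfolding Ck_on_open_def by blast+
  show "continuous_on U F" using c by simp
  show "(F has_derivative frechet_derivative F (at x)) (at x)" if "x \<in> U" for x
    using c that frechet_derivative_works by auto
  show "continuous_on U (\<lambda>x. frechet_derivative F (at x) v)" for v
    using c by simp
qed

lemma Ck_on_open_derivative_tendsto:
  fixes F :: "'a::euclidean_space \<Rightarrow> 'b::real_normed_vector"
  assumes F: "Ck_on_open k F U" "1 \<le> k" and x: "x \<in> U"
    and y: "(y \<longlongrightarrow> x) net" and v: "(v \<longlongrightarrow> w) net"
  shows "((\<lambda>i. frechet_derivative F (at (y i)) (v i)) \<longlongrightarrow> frechet_derivative F (at x) w) net"
proof -
  note D = Ck_on_open_1D[OF F]
  have ev: "\<forall>\<^sub>F i in net. y i \<in> U"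
    using topological_tendstoD[OF y D(1) x] .
  have eq: "frechet_derivative F (at z) u = (\<Sum>b\<in>Basis. (u \<bullet> b) *\<^sub>R frechet_derivative F (at z) b)"
    if "z \<in> U" for z u
  proof -
    have l: "linear (frechet_derivative F (at z))"
      using D(3)[OF that] has_derivative_linear by blast
    have "frechet_derivative F (at z) u
        = frechet_derivative F (at z) (\<Sum>b\<in>Basis. (u \<bullet> b) *\<^sub>R b)"
      by (simp add: euclidean_representation)
    also have "\<dots> = (\<Sum>b\<in>Basis. (u \<bullet> b) *\<^sub>R frechet_derivative F (at z) b)"
      using l by (simp add: linear_sum linear_scale)
    finally show ?thesis .
  qed
  have "((\<lambda>i. \<Sum>b\<in>Basis. (v i \<bullet> b) *\<^sub>R frechet_derivative F (at (y i)) b)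
      \<longlongrightarrow> (\<Sum>b\<in>Basis. (w \<bullet> b) *\<^sub>R frechet_derivative F (at x) b)) net"
    using continuous_on_tendsto_compose[OF D(4) y x ev] v by (intro tendsto_intros)
  then have "((\<lambda>i. \<Sum>b\<in>Basis. (v i \<bullet> b) *\<^sub>R frechet_derivative F (at (y i)) b)
      \<longlongrightarrow> frechet_derivative F (at x) w) net"
    by (simp only: eq[OF x, of w])
  moreover have "\<forall>\<^sub>F i in net. (\<Sum>b\<in>Basis. (v i \<bullet> b) *\<^sub>R frechet_derivative F (at (y i)) b)
      = frechet_derivative F (at (y i)) (v i)"
    using ev by eventually_elim (rule eq[symmetric])
  ultimately show ?thesis by (rule Lim_transform_eventually)
qed

lemma Ck_on_imp_continuous_on:
  assumes "Ck_on k f S"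
  shows "continuous_on S f"
proof (rule continuous_on_eq_continuous_within[THEN iffD2], intro ballI)
  fix x assume x: "x \<in> S"
  obtain U F where U: "x \<in> U" "Ck_on_open k F U" "\<forall>y\<in>S \<inter> U. F y = f y"
    using bspec[OF assms[unfolded Ck_on_def] x] by (elim exE conjE)
  have "enat 0 \<le> k" by (simp add: zero_enat_def[symmetric])
  then have c: "open U" "Cn_on_open 0 F U"
    using U(2) unfolding Ck_on_open_def by blast+
  then have "isCont F x" using U(1) by (simp add: continuous_on_eq_continuous_at)
  then have "continuous (at x within S) F" by (rule continuous_at_imp_continuous_at_within)
  moreover obtain d where d: "d > 0" "\<And>z. dist z x < d \<Longrightarrow> z \<in> U"
    using c(1) U(1) unfolding open_dist by blast
  ultimately show "continuous (at x within S) f"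
    using x U d by (auto intro: continuous_transform_within[of x S F d])
qed

locale slice_chart =
  fixes M E U V :: "'a::euclidean_space set" and \<phi> \<psi> :: "'a \<Rightarrow> 'a"
  assumes E: "subspace E"
    and smooth: "Ck_on_open \<infinity> \<phi> U" "Ck_on_open \<infinity> \<psi> V"
    and homeo: "homeomorphism U V \<phi> \<psi>"
    and slice: "\<phi> ` (M \<inter> U) = E \<inter> V"
begin

lemmas \<phi>D = Ck_on_open_1D[OF smooth(1), simplified]
lemmas \<psi>D = Ck_on_open_1D[OF smooth(2), simplified]

lemma inverse: "z \<in> U \<Longrightarrow> \<psi> (\<phi> z) = z" "a \<in> V \<Longrightarrow> \<phi> (\<psi> a) = a"
  "z \<in> U \<Longrightarrow> \<phi> z \<in> V" "a \<in> V \<Longrightarrow> \<psi> a \<in> U"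
  using homeo unfolding homeomorphism_def by auto

lemma param_in: "a \<in> E \<Longrightarrow> a \<in> V \<Longrightarrow> \<psi> a \<in> M"
proof -
  assume "a \<in> E" "a \<in> V"
  then obtain m where "m \<in> M" "m \<in> U" "a = \<phi> m" using slice by blast
  then show ?thesis by (simp add: inverse)
qed

lemma chart_in: "z \<in> M \<Longrightarrow> z \<in> U \<Longrightarrow> \<phi> z \<in> E \<inter> V"
  using slice by blast

lemma curve_in_param:
  assumes x: "x \<in> M" "x \<in> U" and e: "e \<in> E"
  shows "curve_in M x (frechet_derivative \<psi> (at (\<phi> x)) e) (\<lambda>s. \<psi> (\<phi> x + s *\<^sub>R e))"
proof -
  have a: "\<phi> x \<in> E" "\<phi> x \<in> V" using chart_in[OF x] by auto
  define J where "J = (\<lambda>s::real. \<phi> x + s *\<^sub>R e) -` V"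
  have "open J" unfolding J_def
    by (intro open_vimage \<psi>D(1)) (intro continuous_intros)
  moreover have "0 \<in> J" using a by (simp add: J_def)
  ultimately obtain d where d: "d > 0" "ball 0 d \<subseteq> J"
    using openE by blast
  have dJ: "{-d<..<d} \<subseteq> J" using d(2) by (auto simp: ball_def dist_real_def subset_iff)
  have sm: "Ck_on_open \<infinity> (\<lambda>s. \<psi> (\<phi> x + s *\<^sub>R e)) {-d<..<d}"
    using smooth(2) dJ unfolding Ck_on_open_def J_def
    by (auto intro!: Cn_on_open_line[where U = V])
  have "(\<lambda>s. \<psi> (\<phi> x + s *\<^sub>R e)) ` {-d<..<d} \<subseteq> M"
    using a e dJ E by (auto simp: J_def subspace_add subspace_scale intro!: param_in)
  moreover have "((\<lambda>s. \<psi> (\<phi> x + s *\<^sub>R e)) has_vector_derivative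
      frechet_derivative \<psi> (at (\<phi> x)) e) (at 0)"
  proof -
    have l: "linear (frechet_derivative \<psi> (at (\<phi> x)))"
      using \<psi>D(3)[OF a(2)] has_derivative_linear by blast
    have "((\<lambda>s. \<phi> x + s *\<^sub>R e) has_derivative (\<lambda>h. h *\<^sub>R e)) (at (0::real))"
      by (auto intro!: derivative_eq_intros)
    from has_derivative_compose[OF this, of \<psi> "frechet_derivative \<psi> (at (\<phi> x))"]
    have "((\<lambda>s. \<psi> (\<phi> x + s *\<^sub>R e)) has_derivative
        (\<lambda>h. frechet_derivative \<psi> (at (\<phi> x)) (h *\<^sub>R e))) (at (0::real))"
      using \<psi>D(3)[OF a(2)] by simp
    then show ?thesis using l by (simp add: has_vector_derivative_def linear_scale)
  qed
  ultimately show ?thesis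
    unfolding curve_in_def using d(1) sm x inverse(1) by auto
qed

lemma tangent_space_eq:
  assumes x: "x \<in> M" "x \<in> U"
  shows "tangent_space M x = frechet_derivative \<psi> (at (\<phi> x)) ` E"
proof (intro subset_antisym subsetI)
  fix v assume "v \<in> frechet_derivative \<psi> (at (\<phi> x)) ` E"
  then show "v \<in> tangent_space M x"
    unfolding tangent_space_def using curve_in_param[OF x] by blast
next
  fix v assume "v \<in> tangent_space M x"
  then obtain c d where c: "d > 0" "c ` {-d<..<d} \<subseteq> M" "c 0 = x" "(c has_vector_derivative v) (at 0)"
    unfolding tangent_space_def curve_in_def by blast
  have a: "\<phi> x \<in> E" "\<phi> x \<in> V" using chart_in[OF x] by auto
  define w where "w = frechet_derivative \<phi> (at x) v"
  have c': "(c has_derivative (\<lambda>h. h *\<^sub>R v)) (at 0)"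
    using c(4) by (simp add: has_vector_derivative_def)
  have l: "linear (frechet_derivative \<phi> (at x))" "linear (frechet_derivative \<psi> (at (\<phi> x)))"
    using \<phi>D(3)[OF x(2)] \<psi>D(3)[OF a(2)] has_derivative_linear by blast+
  have pc: "((\<lambda>s. \<phi> (c s)) has_derivative (\<lambda>h. h *\<^sub>R w)) (at 0)"
    using has_derivative_compose[OF c', of \<phi> "frechet_derivative \<phi> (at x)"] \<phi>D(3)[OF x(2)] c(3) l(1)
    by (simp add: w_def linear_scale)
  have "(c \<longlongrightarrow> x) (at 0)"
    using has_derivative_continuous[OF c'] c(3) by (simp add: continuous_at)
  then have evU: "\<forall>\<^sub>F s in at 0. c s \<in> U"
    using topological_tendstoD \<phi>D(1) x(2) by blast
  have evI: "\<forall>\<^sub>F s::real in at 0. s \<in> {-d<..<d}"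
    using c(1) by (intro eventually_at_in_open') auto
  have "\<forall>\<^sub>F s in at 0. (\<phi> (c s) - \<phi> (c 0)) /\<^sub>R s \<in> E"
    using evU evI
  proof eventually_elim
    case (elim s)
    then have "\<phi> (c s) \<in> E" using c(2) chart_in by blast
    then show ?case using a c(3) E by (auto intro: subspace_scale subspace_diff)
  qed
  moreover have "((\<lambda>s. (\<phi> (c s) - \<phi> (c 0)) /\<^sub>R s) \<longlongrightarrow> w) (at 0)"
  proof (rule Lim_null[THEN iffD2], rule tendsto_norm_zero_cancel)
    have "((\<lambda>h. norm (\<phi> (c h) - \<phi> (c 0) - h *\<^sub>R w) / norm h) \<longlongrightarrow> 0) (at 0)"
      using pc by (simp add: has_derivative_at)
    moreover have "\<forall>\<^sub>F h in at (0::real). norm (\<phi> (c h) - \<phi> (c 0) - h *\<^sub>R w) / norm h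
        = norm ((\<phi> (c h) - \<phi> (c 0)) /\<^sub>R h - w)"
    proof (rule eventually_mono[OF eventually_neq_at_within[of 0]])
      fix h :: real assume h: "h \<noteq> 0"
      then have "(\<phi> (c h) - \<phi> (c 0)) /\<^sub>R h - w = (\<phi> (c h) - \<phi> (c 0) - h *\<^sub>R w) /\<^sub>R h"
        by (simp add: scaleR_right_diff_distrib)
      then show "norm (\<phi> (c h) - \<phi> (c 0) - h *\<^sub>R w) / norm h
          = norm ((\<phi> (c h) - \<phi> (c 0)) /\<^sub>R h - w)"
        by (simp add: divide_inverse_commute)
    qed
    ultimately show "((\<lambda>h. norm ((\<phi> (c h) - \<phi> (c 0)) /\<^sub>R h - w)) \<longlongrightarrow> 0) (at 0)"
      by (rule Lim_transform_eventually)
  qed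
  ultimately have w: "w \<in> E"
    using Lim_in_closed_set[OF closed_subspace[OF E]] by (metis at_neq_bot)
  have "((\<lambda>s. \<psi> (\<phi> (c s))) has_derivative (\<lambda>h. h *\<^sub>R frechet_derivative \<psi> (at (\<phi> x)) w)) (at 0)"
    using has_derivative_compose[OF pc, of \<psi> "frechet_derivative \<psi> (at (\<phi> x))"] \<psi>D(3)[OF a(2)] c(3) l(2)
    by (simp add: linear_scale)
  moreover have "\<forall>\<^sub>F s in at 0. \<psi> (\<phi> (c s)) = c s"
    using evU by eventually_elim (simp add: inverse)
  ultimately have "(c has_derivative (\<lambda>h. h *\<^sub>R frechet_derivative \<psi> (at (\<phi> x)) w)) (at 0)"
    using c(3) x inverse(1)[OF x(2)] has_derivative_transform_eventually[of "\<lambda>s. \<psi> (\<phi> (c s))" _ 0 UNIV c]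
    by auto
  then have "frechet_derivative \<psi> (at (\<phi> x)) w = v"
    using has_derivative_unique[OF _ c'] by (metis scaleR_one)
  then show "v \<in> frechet_derivative \<psi> (at (\<phi> x)) ` E" using w by blast
qed

lemma tangent_space_subspace_dim:
  assumes x: "x \<in> M" "x \<in> U"
  shows "subspace (tangent_space M x)" "dim (tangent_space M x) = dim E"
proof -
  have a: "\<phi> x \<in> V" using chart_in[OF x] by auto
  note d = \<psi>D(3)[OF a]
  have l: "linear (frechet_derivative \<psi> (at (\<phi> x)))" using d has_derivative_linear by blast
  show "subspace (tangent_space M x)"
    using linear_subspace_image[OF l E] tangent_space_eq[OF x] by simp
  have "((\<lambda>z. \<phi> (\<psi> z)) has_derivative
      (\<lambda>h. frechet_derivative \<phi> (at x) (frechet_derivative \<psi> (at (\<phi> x)) h))) (at (\<phi> x))"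
    using has_derivative_compose[OF d, of \<phi>] \<phi>D(3)[OF x(2)] inverse(1)[OF x(2)] by simp
  then have "((\<lambda>z. z) has_derivative
      (\<lambda>h. frechet_derivative \<phi> (at x) (frechet_derivative \<psi> (at (\<phi> x)) h))) (at (\<phi> x))"
    by (rule has_derivative_transform_within_open[OF _ \<psi>D(1) a]) (simp add: inverse)
  then have "frechet_derivative \<phi> (at x) (frechet_derivative \<psi> (at (\<phi> x)) h) = h" for h
    using has_derivative_unique[OF _ has_derivative_ident] by metis
  then have "inj (frechet_derivative \<psi> (at (\<phi> x)))" by (metis injI)
  then show "dim (tangent_space M x) = dim E"
    unfolding tangent_space_eq[OF x] by (rule dim_image_eq[OF l inj_on_subset[OF _ subset_UNIV]])
qed

end

lemma embedded_submanifold_charts: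
  assumes "embedded_submanifold M"
  obtains E where "\<And>x. x \<in> M \<Longrightarrow> \<exists>U V \<phi> \<psi>. x \<in> U \<and> slice_chart M E U V \<phi> \<psi>"
proof -
  obtain E where E: "subspace E" and ch: "\<forall>x\<in>M. \<exists>U V (\<phi> :: 'a \<Rightarrow> 'a) \<psi>. x \<in> U \<and>
      Ck_on_open \<infinity> \<phi> U \<and> Ck_on_open \<infinity> \<psi> V \<and> homeomorphism U V \<phi> \<psi> \<and> \<phi> ` (M \<inter> U) = E \<inter> V"
    using assms unfolding embedded_submanifold_def by (elim exE conjE)
  show ?thesis
  proof (rule that)
    fix x assume "x \<in> M"
    with ch show "\<exists>U V \<phi> \<psi>. x \<in> U \<and> slice_chart M E U V \<phi> \<psi>"
      unfolding slice_chart_def using E by simp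
  qed
qed

lemma tangent_space_subspace:
  assumes "embedded_submanifold M" "x \<in> M"
  shows "subspace (tangent_space M x)"
  using embedded_submanifold_charts[OF assms(1)] slice_chart.tangent_space_subspace_dim(1) assms(2)
  by metis

lemma tangent_space_dim_eq:
  assumes "embedded_submanifold M" "x \<in> M" "y \<in> M"
  shows "dim (tangent_space M x) = dim (tangent_space M y)"
  using embedded_submanifold_charts[OF assms(1)] slice_chart.tangent_space_subspace_dim(2) assms(2,3)
  by metis

lemma curve_in_continuous:
  assumes "curve_in M x v c"
  shows "(c \<longlongrightarrow> x) (at 0)" "\<forall>\<^sub>F s in at 0. c s \<in> M"
proof -
  have c: "c 0 = x" "(c has_vector_derivative v) (at 0)"
    using assms unfolding curve_in_def by auto
  show "(c \<longlongrightarrow> x) (at 0)"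
    using has_vector_derivative_continuous[OF c(2)] c(1) by (simp add: continuous_at)
  obtain d where "d > 0" "c ` {-d<..<d} \<subseteq> M"
    using assms unfolding curve_in_def by blast
  moreover have "\<forall>\<^sub>F s::real in at 0. s \<in> {-d<..<d}"
    using \<open>d > 0\<close> by (intro eventually_at_in_open') auto
  ultimately show "\<forall>\<^sub>F s in at 0. c s \<in> M"
    by (auto elim!: eventually_mono)
qed

subsection \<open>Gradients and transports\<close>

lemma differential_on_eq:
  fixes F :: "'a::euclidean_space \<Rightarrow> real"
  assumes F: "(F has_derivative D) (at x)" and U: "open U" "x \<in> U"
    and eq: "\<And>y. y \<in> M \<inter> U \<Longrightarrow> F y = f y" and x: "x \<in> M" and v: "v \<in> tangent_space M x"
  shows "differential_on M f x v = D v"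
proof -
  have der: "((\<lambda>t. f (c t)) has_real_derivative D v) (at 0)" if c: "curve_in M x v c" for c
  proof -
    have c0: "c 0 = x" "(c has_derivative (\<lambda>h. h *\<^sub>R v)) (at 0)"
      using c unfolding curve_in_def has_vector_derivative_def by auto
    have "((\<lambda>t. F (c t)) has_derivative (\<lambda>h. D (h *\<^sub>R v))) (at 0)"
      using has_derivative_compose[OF c0(2), of F D] F c0(1) by simp
    moreover have "\<forall>\<^sub>F t in at 0. F (c t) = f (c t)"
      using curve_in_continuous(2)[OF c] topological_tendstoD[OF curve_in_continuous(1)[OF c] U]
      by eventually_elim (simp add: eq)
    ultimately have "((\<lambda>t. f (c t)) has_derivative (\<lambda>h. D (h *\<^sub>R v))) (at 0)"
      by (rule has_derivative_transform_eventually) (use c0 eq x U in auto)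
    moreover have "D (h *\<^sub>R v) = D v * h" for h
      using has_derivative_linear[OF F] by (simp add: linear_scale mult.commute)
    ultimately show ?thesis by (simp add: has_field_derivative_def)
  qed
  obtain c where c: "curve_in M x v c" using v unfolding tangent_space_def by blast
  show ?thesis
    unfolding differential_on_def
  proof (rule the_equality)
    show "\<forall>c. curve_in M x v c \<longrightarrow> ((\<lambda>t. f (c t)) has_real_derivative D v) (at 0)"
      using der by blast
    show "d = D v" if "\<forall>c. curve_in M x v c \<longrightarrow> ((\<lambda>t. f (c t)) has_real_derivative d) (at 0)" for d
      using that c DERIV_unique[OF _ der[OF c]] by blast
  qed
qed

lemma inner_on_tangent_space:
  assumes "embedded_submanifold M" "riemannian_metric M \<rho>" "x \<in> M"
  shows "inner_on (tangent_space M x) (\<rho> x)"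
proof
  show "subspace (tangent_space M x)" using assms by (simp add: tangent_space_subspace)
qed (use assms in \<open>auto simp: riemannian_metric_def\<close>)

lemma rgrad:
  assumes M: "embedded_submanifold M" "riemannian_metric M \<rho>" and f: "Ck_on 1 f M" and x: "x \<in> M"
  shows "rgrad M \<rho> f x \<in> tangent_space M x"
    and "\<xi> \<in> tangent_space M x \<Longrightarrow> \<rho> x (rgrad M \<rho> f x) \<xi> = differential_on M f x \<xi>"
    and "(\<And>\<xi>. \<xi> \<in> tangent_space M x \<Longrightarrow> differential_on M f x \<xi> = 0) \<Longrightarrow> rgrad M \<rho> f x = 0"
proof -
  interpret inner_on "tangent_space M x" "\<rho> x" using M x by (rule inner_on_tangent_space)
  obtain U F where U: "x \<in> U" "Ck_on_open 1 F U" "\<forall>y\<in>M \<inter> U. F y = f y"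
    using bspec[OF f[unfolded Ck_on_def] x] by (elim exE conjE)
  note D = Ck_on_open_1D[OF U(2) order_refl]
  have "differential_on M f x \<xi> = frechet_derivative F (at x) \<xi>" if "\<xi> \<in> tangent_space M x" for \<xi>
    using D(3)[OF U(1)] D(1) U(1) _ x that by (rule differential_on_eq) (use U in auto)
  then have ex1: "\<exists>!v. v \<in> tangent_space M x \<and>
      (\<forall>\<xi>\<in>tangent_space M x. \<rho> x v \<xi> = differential_on M f x \<xi>)"
    using riesz[OF has_derivative_linear[OF D(3)[OF U(1)]]] by simp
  have g: "rgrad M \<rho> f x \<in> tangent_space M x \<and>
      (\<forall>\<xi>\<in>tangent_space M x. \<rho> x (rgrad M \<rho> f x) \<xi> = differential_on M f x \<xi>)"
    unfolding rgrad_def by (rule theI'[OF ex1])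
  then show g1: "rgrad M \<rho> f x \<in> tangent_space M x" by blast
  show "\<rho> x (rgrad M \<rho> f x) \<xi> = differential_on M f x \<xi>" if "\<xi> \<in> tangent_space M x"
    using g that by blast
  show "rgrad M \<rho> f x = 0" if "\<And>\<xi>. \<xi> \<in> tangent_space M x \<Longrightarrow> differential_on M f x \<xi> = 0"
    using self_eq_zero[OF g1] g that g1 by simp
qed

lemma rnorm_nonneg:
  assumes "embedded_submanifold M" "riemannian_metric M \<rho>" "x \<in> M" "v \<in> tangent_space M x"
  shows "0 \<le> rnorm \<rho> x v"
  using inner_on.nonneg[OF inner_on_tangent_space[OF assms(1-3)] assms(4)] by (simp add: rnorm_def)

text \<open>Tangent vectors at the limit are limits of tangent vectors along the sequence, obtained by
  freezing their coordinates in a chart. This makes continuity of the gradient field unnecessary.\<close>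

lemma rgrad_limit_eq_zero:
  assumes M: "embedded_submanifold M" "riemannian_metric M \<rho>" and f: "Ck_on 1 f M"
    and y: "\<And>k::nat. y k \<in> M" and x: "x \<in> M" and lim: "y \<longlonglongrightarrow> x"
    and grad: "(\<lambda>k. rnorm \<rho> (y k) (rgrad M \<rho> f (y k))) \<longlonglongrightarrow> 0"
  shows "rgrad M \<rho> f x = 0"
proof (rule rgrad(3)[OF M f x])
  fix \<xi> assume \<xi>: "\<xi> \<in> tangent_space M x"
  obtain E W V \<phi> \<psi> where xW: "x \<in> W" and "slice_chart M E W V \<phi> \<psi>"
    using embedded_submanifold_charts[OF M(1)] x by metis
  then interpret slice_chart M E W V \<phi> \<psi> by simp
  obtain U F where U: "x \<in> U" "Ck_on_open 1 F U" "\<forall>y\<in>M \<inter> U. F y = f y"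
    using bspec[OF f[unfolded Ck_on_def] x] by (elim exE conjE)
  note D = Ck_on_open_1D[OF U(2) order_refl]
  have dF: "differential_on M f z \<zeta> = frechet_derivative F (at z) \<zeta>"
    if "z \<in> M" "z \<in> U" "\<zeta> \<in> tangent_space M z" for z \<zeta>
    using D(3)[OF that(2)] D(1) that(2) _ that(1,3) by (rule differential_on_eq) (use U in auto)
  obtain e where e: "e \<in> E" "\<xi> = frechet_derivative \<psi> (at (\<phi> x)) e"
    using \<xi> tangent_space_eq[OF x xW] by blast
  define \<zeta> where "\<zeta> k = frechet_derivative \<psi> (at (\<phi> (y k))) e" for k
  have ev: "\<forall>\<^sub>F k in sequentially. y k \<in> W \<inter> U"
    using lim \<phi>D(1) D(1) xW U(1) by (intro topological_tendstoD) auto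
  have "(\<lambda>k. \<phi> (y k)) \<longlonglongrightarrow> \<phi> x"
    using \<phi>D(2) lim xW by (rule continuous_on_tendsto_compose) (use ev in \<open>auto elim: eventually_mono\<close>)
  then have \<zeta>: "\<zeta> \<longlonglongrightarrow> \<xi>"
    unfolding \<zeta>_def e(2) using inverse(3)[OF xW]
    by (intro Ck_on_open_derivative_tendsto[OF smooth(2)] tendsto_const) auto
  have tan: "\<forall>\<^sub>F k in sequentially. \<zeta> k \<in> tangent_space M (y k)"
    using ev by eventually_elim (use y e(1) in \<open>auto simp: tangent_space_eq \<zeta>_def\<close>)
  have "continuous_on (tangent_bundle2 M) (\<lambda>(x, u, v). \<rho> x u v)"
    using M(2) unfolding riemannian_metric_def by (intro Ck_on_imp_continuous_on) blast
  then have "(\<lambda>k. (\<lambda>(x, u, v). \<rho> x u v) (y k, \<zeta> k, \<zeta> k)) \<longlonglongrightarrow> (\<lambda>(x, u, v). \<rho> x u v) (x, \<xi>, \<xi>)"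
  proof (rule continuous_on_tendsto_compose)
    show "(\<lambda>k. (y k, \<zeta> k, \<zeta> k)) \<longlonglongrightarrow> (x, \<xi>, \<xi>)" by (intro tendsto_Pair lim \<zeta>)
    show "(x, \<xi>, \<xi>) \<in> tangent_bundle2 M" using x \<xi> by (simp add: tangent_bundle2_def)
    show "\<forall>\<^sub>F k in sequentially. (y k, \<zeta> k, \<zeta> k) \<in> tangent_bundle2 M"
      using tan by eventually_elim (use y in \<open>simp add: tangent_bundle2_def\<close>)
  qed
  then have "(\<lambda>k. rnorm \<rho> (y k) (\<zeta> k)) \<longlonglongrightarrow> rnorm \<rho> x \<xi>"
    unfolding rnorm_def by (intro tendsto_real_sqrt) simp
  from tendsto_mult[OF grad this]
  have zero: "(\<lambda>k. rnorm \<rho> (y k) (rgrad M \<rho> f (y k)) * rnorm \<rho> (y k) (\<zeta> k)) \<longlonglongrightarrow> 0" by simp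
  have "\<forall>\<^sub>F k in sequentially. norm (frechet_derivative F (at (y k)) (\<zeta> k))
      \<le> rnorm \<rho> (y k) (rgrad M \<rho> f (y k)) * rnorm \<rho> (y k) (\<zeta> k)"
    using ev tan
  proof eventually_elim
    case (elim k)
    interpret inner_on "tangent_space M (y k)" "\<rho> (y k)" using M y by (rule inner_on_tangent_space)
    show ?case
      using cauchy_schwarz[OF rgrad(1)[OF M f y] elim(2)] elim y rgrad(2)[OF M f y elim(2)] dF[of "y k" "\<zeta> k"]
      by (simp add: rnorm_def)
  qed
  then have "(\<lambda>k. frechet_derivative F (at (y k)) (\<zeta> k)) \<longlonglongrightarrow> 0"
    by (rule Lim_null_comparison[OF _ zero])
  moreover have "(\<lambda>k. frechet_derivative F (at (y k)) (\<zeta> k)) \<longlonglongrightarrow> frechet_derivative F (at x) \<xi>"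
    using U(1) lim \<zeta> by (intro Ck_on_open_derivative_tendsto[OF U(2)]) auto
  ultimately have "frechet_derivative F (at x) \<xi> = 0" by (rule LIMSEQ_unique[symmetric])
  then show "differential_on M f x \<xi> = 0" using dF x U(1) \<xi> by simp
qed

lemma inv_transport:
  assumes M: "embedded_submanifold M" "riemannian_metric M \<rho>" and R: "manifold_retraction M R"
    and T: "vector_transport M R T" "isometric_transport M \<rho> R T"
    and x: "x \<in> M" and \<eta>: "\<eta> \<in> tangent_space M x" and \<zeta>: "\<zeta> \<in> tangent_space M (R x \<eta>)"
  shows "inv_transport M T x \<eta> \<zeta> \<in> tangent_space M x"
    and "rnorm \<rho> x (inv_transport M T x \<eta> \<zeta>) = rnorm \<rho> (R x \<eta>) \<zeta>"
proof -
  have Rx: "R x \<eta> \<in> M" using R x \<eta> unfolding manifold_retraction_def by blast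
  interpret A: inner_on "tangent_space M x" "\<rho> x" using M x by (rule inner_on_tangent_space)
  interpret B: inner_on "tangent_space M (R x \<eta>)" "\<rho> (R x \<eta>)"
    using M Rx by (rule inner_on_tangent_space)
  have iso: "\<rho> (R x \<eta>) (T x \<eta> v) (T x \<eta> v) = \<rho> x v v" if "v \<in> tangent_space M x" for v
    using T(2) x \<eta> that unfolding isometric_transport_def by blast
  have "T x \<eta> ` tangent_space M x = tangent_space M (R x \<eta>)"
  proof (rule linear_inj_on_subspace_surj[OF A.subspace B.subspace])
    show "T x \<eta> (a *\<^sub>R u + b *\<^sub>R v) = a *\<^sub>R T x \<eta> u + b *\<^sub>R T x \<eta> v"
      if "u \<in> tangent_space M x" "v \<in> tangent_space M x" for u v a b
      using T(1) x \<eta> that unfolding vector_transport_def by blast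
    show "v = 0" if "v \<in> tangent_space M x" "T x \<eta> v = 0" for v
      using iso[OF that(1)] that(2) A.self_eq_zero[OF that(1)] B.zero_left[OF subspace_0[OF B.subspace]]
      by simp
    show "T x \<eta> ` tangent_space M x \<subseteq> tangent_space M (R x \<eta>)"
      using T(1) x \<eta> unfolding vector_transport_def by blast
    show "dim (tangent_space M (R x \<eta>)) \<le> dim (tangent_space M x)"
      using tangent_space_dim_eq[OF M(1) Rx x] by simp
  qed
  then have \<zeta>': "\<zeta> \<in> T x \<eta> ` tangent_space M x" using \<zeta> by simp
  show in_T: "inv_transport M T x \<eta> \<zeta> \<in> tangent_space M x"
    unfolding inv_transport_def using \<zeta>' by (rule inv_into_into)
  have "T x \<eta> (inv_transport M T x \<eta> \<zeta>) = \<zeta>"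
    unfolding inv_transport_def using \<zeta>' by (rule f_inv_into_f)
  then show "rnorm \<rho> x (inv_transport M T x \<eta> \<zeta>) = rnorm \<rho> (R x \<eta>) \<zeta>"
    using iso[OF in_T] by (simp add: rnorm_def)
qed

lemma rgrad_norm_lipschitz:
  assumes M: "embedded_submanifold M" "riemannian_metric M \<rho>" and R: "manifold_retraction M R"
    and T: "vector_transport M R T" "isometric_transport M \<rho> R T"
    and f: "Ck_on 1 f M" and lip: "lipschitz_gradient M \<rho> R T f L"
    and x: "x \<in> M" and \<eta>: "\<eta> \<in> tangent_space M x"
  shows "\<bar>rnorm \<rho> (R x \<eta>) (rgrad M \<rho> f (R x \<eta>)) - rnorm \<rho> x (rgrad M \<rho> f x)\<bar> \<le> L * rnorm \<rho> x \<eta>"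
proof -
  have Rx: "R x \<eta> \<in> M" using R x \<eta> unfolding manifold_retraction_def by blast
  interpret inner_on "tangent_space M x" "\<rho> x" using M x by (rule inner_on_tangent_space)
  note inv = inv_transport[OF M R T x \<eta> rgrad(1)[OF M f Rx]]
  have "\<bar>rnorm \<rho> (R x \<eta>) (rgrad M \<rho> f (R x \<eta>)) - rnorm \<rho> x (rgrad M \<rho> f x)\<bar>
      \<le> rnorm \<rho> x (inv_transport M T x \<eta> (rgrad M \<rho> f (R x \<eta>)) - rgrad M \<rho> f x)"
    using reverse_triangle[OF inv(1) rgrad(1)[OF M f x]] unfolding inv(2)[symmetric] by (simp add: rnorm_def)
  also have "\<dots> \<le> L * rnorm \<rho> x \<eta>" using lip x \<eta> unfolding lipschitz_gradient_def by blast
  finally show ?thesis .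
qed

lemma sufficient_decrease:
  assumes M: "embedded_submanifold M" "riemannian_metric M \<rho>" and f: "Ck_on 1 f M"
    and desc: "descent_condition M \<rho> R f L" and L: "L > 0" and \<nu>: "0 \<le> \<nu>"
    and t: "0 \<le> t" "t \<le> (2 - 2 * \<nu> - \<delta>) / (L * (1 + \<nu>)\<^sup>2)"
    and x: "x \<in> M" and g: "g \<in> tangent_space M x"
    and err: "rnorm \<rho> x (g - rgrad M \<rho> f x) \<le> \<nu> * rnorm \<rho> x (rgrad M \<rho> f x)"
  shows "f (R x (- t *\<^sub>R g)) \<le> f x - \<delta> / 2 * (t * (rnorm \<rho> x (rgrad M \<rho> f x))\<^sup>2)"
proof -
  interpret inner_on "tangent_space M x" "\<rho> x" using M x by (rule inner_on_tangent_space)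
  define G where "G = rgrad M \<rho> f x"
  have G: "G \<in> tangent_space M x" unfolding G_def using rgrad(1)[OF M f x] .
  note dir = inexact_direction[OF G g err[folded G_def, unfolded rnorm_def]]
  have \<eta>: "- t *\<^sub>R g \<in> tangent_space M x" using subspace g by (rule subspace_scale)
  have "f (R x (- t *\<^sub>R g)) \<le> f x + \<rho> x G (- t *\<^sub>R g) + L / 2 * (N (- t *\<^sub>R g))\<^sup>2"
    using desc x \<eta> unfolding descent_condition_def G_def rnorm_def by blast
  also have "\<rho> x G (- t *\<^sub>R g) = - (t * \<rho> x G g)"
    using lin_right[OF g g G, of "- t" 0] by simp
  also have "(N (- t *\<^sub>R g))\<^sup>2 = t\<^sup>2 * (N g)\<^sup>2"
    using norm_scale[OF g, of "- t"] by (simp add: power_mult_distrib)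
  also have "f x + - (t * \<rho> x G g) + L / 2 * (t\<^sup>2 * (N g)\<^sup>2)
      \<le> f x + - (t * ((1 - \<nu>) * (N G)\<^sup>2)) + L / 2 * (t\<^sup>2 * ((1 + \<nu>) * N G)\<^sup>2)"
    using dir t(1) L nonneg[OF g]
    by (intro add_mono mult_left_mono power_mono le_imp_neg_le) auto
  also have "\<dots> = f x - t * (N G)\<^sup>2 * ((1 - \<nu>) - t * (L * (1 + \<nu>)\<^sup>2) / 2)"
    by (simp add: power2_eq_square algebra_simps)
  also have "\<dots> \<le> f x - t * (N G)\<^sup>2 * (\<delta> / 2)"
  proof -
    have "t * (L * (1 + \<nu>)\<^sup>2) \<le> 2 - 2 * \<nu> - \<delta>"
      using t(2) L \<nu> by (simp add: pos_le_divide_eq)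
    then have "\<delta> / 2 \<le> (1 - \<nu>) - t * (L * (1 + \<nu>)\<^sup>2) / 2" by argo
    then have "t * (N G)\<^sup>2 * (\<delta> / 2) \<le> t * (N G)\<^sup>2 * ((1 - \<nu>) - t * (L * (1 + \<nu>)\<^sup>2) / 2)"
      using t(1) by (intro mult_left_mono) auto
    then show ?thesis by simp
  qed
  finally show ?thesis by (simp add: G_def rnorm_def algebra_simps)
qed

theorem theorem3p13:
  fixes M :: "(real ^ 'n) set"
    and \<rho> :: "real ^ 'n \<Rightarrow> real ^ 'n \<Rightarrow> real ^ 'n \<Rightarrow> real"
    and R :: "real ^ 'n \<Rightarrow> real ^ 'n \<Rightarrow> real ^ 'n"
    and T :: "real ^ 'n \<Rightarrow> real ^ 'n \<Rightarrow> real ^ 'n \<Rightarrow> real ^ 'n"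
    and f :: "real ^ 'n \<Rightarrow> real"
    and x g :: "nat \<Rightarrow> real ^ 'n"
    and t :: "nat \<Rightarrow> real"
    and L \<nu> \<delta> :: real
  assumes "embedded_submanifold M"
    and "riemannian_metric M \<rho>"
    and "manifold_retraction M R"
    and "vector_transport M R T"
    and "isometric_transport M \<rho> R T"
    and "Ck_on 1 f M"
    and "L > 0"
    and "descent_condition M \<rho> R f L"
    and "lipschitz_gradient M \<rho> R T f L"
    and "0 \<le> \<nu>" and "\<nu> < 1"
    and "\<forall>k\<ge>1. t k \<ge> 0"
    and "filterlim (\<lambda>n. \<Sum>k=1..n. t k) at_top sequentially"
    and "\<delta> > 0"
    and "\<forall>\<^sub>F k in sequentially. t k \<in> {0..(2 - 2 * \<nu> - \<delta>) / (L * (1 + \<nu>)\<^sup>2)}"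
    and "\<forall>k\<ge>1. x k \<in> M"
    and "\<forall>k\<ge>1. g k \<in> tangent_space M (x k)"
    and "\<forall>k\<ge>1. rnorm \<rho> (x k) (g k - rgrad M \<rho> f (x k)) \<le> \<nu> * rnorm \<rho> (x k) (rgrad M \<rho> f (x k))"
    and "\<forall>k\<ge>1. x (Suc k) = R (x k) (- t k *\<^sub>R g k)"
    and "bdd_below ((\<lambda>k. f (x k)) ` {1..})"
  shows "filterlim (\<lambda>k. f (x k)) at_bot sequentially \<or>
    ((\<forall>xbar. accumulation_point_in M x xbar \<longrightarrow> stationary_point M \<rho> f xbar) \<and>
     (\<forall>xbar. accumulation_point_in M x xbar \<longrightarrow> decreases_to (\<lambda>k. f (x k)) (f xbar)) \<and>
     (lipschitz_gradient M \<rho> R T f L \<longrightarrow>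
        (\<lambda>k. rnorm \<rho> (x k) (rgrad M \<rho> f (x k))) \<longlonglongrightarrow> 0))"
proof -
  note M = assms(1,2) and R = assms(3) and T = assms(4,5) and f = assms(6) and L = assms(7)
    and desc = assms(8) and lip = assms(9) and \<nu> = assms(10,11) and \<delta> = assms(14)
  define G where "G k = rnorm \<rho> (x k) (rgrad M \<rho> f (x k))" for k
  have xM: "x k \<in> M" and gT: "g k \<in> tangent_space M (x k)"
    and err: "rnorm \<rho> (x k) (g k - rgrad M \<rho> f (x k)) \<le> \<nu> * rnorm \<rho> (x k) (rgrad M \<rho> f (x k))"
    and next_x: "x (Suc k) = R (x k) (- t k *\<^sub>R g k)" and t0: "0 \<le> t k"
    if "k \<ge> 1" for k
    using assms(12,16-19) that by blast+
  define B where "B = (2 - 2 * \<nu> - \<delta>) / (L * (1 + \<nu>)\<^sup>2)"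
  obtain K where K: "\<And>k. k \<ge> K \<Longrightarrow> t k \<le> B"
    using assms(15) unfolding B_def eventually_sequentially by auto
  have dec: "f (x (Suc k)) \<le> f (x k) - \<delta> / 2 * (t k * (G k)\<^sup>2)" if "k \<ge> Suc K" for k
    using sufficient_decrease[OF M f desc L \<nu>(1) t0 K[unfolded B_def] xM gT err] that
    by (simp add: next_x G_def)
  have G0: "0 \<le> G k" if "k \<ge> 1" for k
    unfolding G_def using rnorm_nonneg[OF M xM rgrad(1)[OF M f xM]] that by blast
  have step: "\<bar>G (Suc k) - G k\<bar> \<le> L * (1 + \<nu>) * t k * G k" if k: "k \<ge> 1" for k
  proof -
    interpret inner_on "tangent_space M (x k)" "\<rho> (x k)" using M xM[OF k] by (rule inner_on_tangent_space)
    have "\<bar>G (Suc k) - G k\<bar> \<le> L * rnorm \<rho> (x k) (- t k *\<^sub>R g k)"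
      using rgrad_norm_lipschitz[OF M R T f lip xM[OF k] subspace_scale[OF subspace gT[OF k], of "- t k"]]
      unfolding G_def next_x[OF k] .
    also have "rnorm \<rho> (x k) (- t k *\<^sub>R g k) = t k * rnorm \<rho> (x k) (g k)"
      using norm_scale[OF gT[OF k], of "- t k"] t0[OF k] by (simp add: rnorm_def)
    also have "L * (t k * rnorm \<rho> (x k) (g k)) \<le> L * (t k * ((1 + \<nu>) * G k))"
      using inexact_direction(1)[OF rgrad(1)[OF M f xM[OF k]] gT[OF k]] err[OF k] t0[OF k] L
      by (intro mult_left_mono) (auto simp: G_def rnorm_def)
    finally show ?thesis by (simp add: algebra_simps)
  qed
  obtain m where m: "\<And>k. k \<ge> 1 \<Longrightarrow> m \<le> f (x k)"
    using assms(20) unfolding bdd_below_def by auto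
  have "G \<longlonglongrightarrow> 0"
  proof (rule LIMSEQ_offset[of G "Suc K"], rule tendsto_zero_if_weighted_squares_summable)
    show "0 \<le> t (k + Suc K)" "t (k + Suc K) \<le> B" "0 \<le> G (k + Suc K)" for k
      using t0 K G0 by auto
    show "\<bar>G (Suc k + Suc K) - G (k + Suc K)\<bar> \<le> L * (1 + \<nu>) * t (k + Suc K) * G (k + Suc K)" for k
      using step[of "k + Suc K"] by simp
    show "0 \<le> L * (1 + \<nu>)" using L \<nu> by simp
    show "\<not> summable (\<lambda>k. t (k + Suc K))"
    proof
      assume "summable (\<lambda>k. t (k + Suc K))"
      then have "summable (\<lambda>k. t (Suc k))"
        using summable_iff_shift[of "\<lambda>k. t (Suc k)" K] by simp
      then have "(\<Sum>k<n. t (Suc k)) \<le> (\<Sum>k. t (Suc k))" for n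
        by (intro sum_le_suminf) (auto simp: t0)
      moreover have "(\<Sum>k=1..n. t k) = (\<Sum>k<n. t (Suc k))" for n
        by (simp add: sum.atLeast1_atMost_eq)
      moreover obtain n where "(\<Sum>k=1..n. t k) > (\<Sum>k. t (Suc k))"
        using assms(13) unfolding filterlim_at_top_dense eventually_sequentially by blast
      ultimately show False by (metis not_less)
    qed
    show "summable (\<lambda>k. t (k + Suc K) * (G (k + Suc K))\<^sup>2)"
    proof (rule bounded_imp_summable)
      show "0 \<le> t (k + Suc K) * (G (k + Suc K))\<^sup>2" for k using t0 by simp
      have tele: "\<delta> / 2 * (\<Sum>k<n. t (k + Suc K) * (G (k + Suc K))\<^sup>2) \<le> f (x (Suc K)) - f (x (n + Suc K))" for n
      proof (induction n)
        case (Suc n)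
        then show ?case using dec[of "n + Suc K"] by (simp add: distrib_left)
      qed simp
      show "(\<Sum>k\<le>n. t (k + Suc K) * (G (k + Suc K))\<^sup>2) \<le> (f (x (Suc K)) - m) * 2 / \<delta>" for n
        using tele[of "Suc n"] m[of "Suc n + Suc K"] \<delta>
        by (simp add: lessThan_Suc_atMost pos_le_divide_eq mult.commute)
    qed
  qed
  moreover have "stationary_point M \<rho> f xbar" if acc: "accumulation_point_in M x xbar" for xbar
  proof -
    obtain r :: "nat \<Rightarrow> nat" where r: "xbar \<in> M" "strict_mono r" "(x \<circ> r) \<longlonglongrightarrow> xbar"
      using acc unfolding accumulation_point_in_def by blast
    have r1: "r (Suc k) \<ge> 1" for k using seq_suble[OF r(2), of "Suc k"] by simp
    have "(\<lambda>k. G (r (Suc k))) \<longlonglongrightarrow> 0"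
      using LIMSEQ_Suc[OF LIMSEQ_subseq_LIMSEQ[OF \<open>G \<longlonglongrightarrow> 0\<close> r(2)]] by simp
    then have "rgrad M \<rho> f xbar = 0"
      using LIMSEQ_Suc[OF r(3)] r1 xM r(1)
      by (intro rgrad_limit_eq_zero[OF M f, of "\<lambda>k. x (r (Suc k))"]) (auto simp: G_def)
    then show ?thesis using r(1) by (simp add: stationary_point_def)
  qed
  moreover have "decreases_to (\<lambda>k. f (x k)) (f xbar)" if acc: "accumulation_point_in M x xbar" for xbar
  proof -
    obtain r :: "nat \<Rightarrow> nat" where r: "xbar \<in> M" "strict_mono r" "(x \<circ> r) \<longlonglongrightarrow> xbar"
      using acc unfolding accumulation_point_in_def by blast
    have mono: "f (x (Suc k)) \<le> f (x k)" if "k \<ge> Suc K" for k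
    proof -
      have "0 \<le> \<delta> / 2 * (t k * (G k)\<^sup>2)" using \<delta> t0[of k] that by simp
      then show ?thesis using dec[OF that] by linarith
    qed
    have "decseq (\<lambda>k. f (x (k + Suc K)))"
      using mono by (simp add: decseq_Suc_iff)
    moreover have "\<forall>k. m \<le> f (x (k + Suc K))" using m by simp
    ultimately obtain l where "(\<lambda>k. f (x (k + Suc K))) \<longlonglongrightarrow> l"
      using decseq_convergent[of "\<lambda>k. f (x (k + Suc K))" m] by blast
    then have l: "(\<lambda>k. f (x k)) \<longlonglongrightarrow> l" by (rule LIMSEQ_offset)
    have "\<forall>\<^sub>F k in sequentially. (x \<circ> r) k \<in> M"
      using eventually_ge_at_top[of 1]
    proof eventually_elim
      case (elim k)
      then show ?case using seq_suble[OF r(2), of k] xM by simp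
    qed
    then have "(\<lambda>k. f ((x \<circ> r) k)) \<longlonglongrightarrow> f xbar"
      using continuous_on_tendsto_compose[OF Ck_on_imp_continuous_on[OF f] r(3,1)] by blast
    moreover have "(\<lambda>k. f ((x \<circ> r) k)) \<longlonglongrightarrow> l"
      using LIMSEQ_subseq_LIMSEQ[OF l r(2)] by (simp add: o_def)
    ultimately have "l = f xbar" using LIMSEQ_unique by blast
    then show ?thesis
      using l mono unfolding decreases_to_def eventually_sequentially by blast
  qed
  ultimately show ?thesis unfolding G_def by blast
qed

end
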